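(* Let $(A,[\,])$ be a ternary group. The following conditions are equivalent: (1) $(A,[\,])$ is a knot-theoretic ternary group; (2) there is an abelian group $(A,+)$ on the set $A$, with neutral element $e\in A$, such that $[xyz]=x-y+z+\bar e$ for all $x,y,z\in A$, and the mapping $A\to A$, $x\mapsto\bar x$, is an involutive bijection such that $\bar x=x+\bar e$ for every $x\in A$.
   Context: A ternary groupoid $(A,[\,])$ is a non-empty set $A$ with a ternary operation $[\,]\colon A^3\to A$. It is a ternary quasigroup if for all $a,b,c\in A$ each of the equations $[zab]=c$, $[azb]=c$, $[abz]=c$ has a unique solution $z\in A$. A ternary group is a ternary quasigroup that is associative: $[[abc]de]=[a[bcd]e]=[ab[cde]]$ for all $a,b,c,d,e\in A$. In a ternary group, the skew element $\bar a$ of $a$ is the unique solution $z$ of $[aza]=a$. A knot-theoretic ternary group is a ternary group such that, for all $a,b,c,d\in A$, $[[abc]cd]=[[ab[bcd]][bcd]d]$ and $[ab[bcd]]=[a[abc][[abc]cd]]$. *)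

theory Defs
  imports "HOL-Algebra.Group"
begin

locale ternary_groupoid =
  fixes A :: "'a set" and T :: "'a \<Rightarrow> 'a \<Rightarrow> 'a \<Rightarrow> 'a"
  assumes nonempty: "A \<noteq> {}"
    and closed: "\<lbrakk>a \<in> A; b \<in> A; c \<in> A\<rbrakk> \<Longrightarrow> T a b c \<in> A"

locale ternary_quasigroup = ternary_groupoid +
  assumes solvable_left: "\<lbrakk>a \<in> A; b \<in> A; c \<in> A\<rbrakk> \<Longrightarrow> \<exists>!z. z \<in> A \<and> T z a b = c"
    and solvable_middle: "\<lbrakk>a \<in> A; b \<in> A; c \<in> A\<rbrakk> \<Longrightarrow> \<exists>!z. z \<in> A \<and> T a z b = c"
    and solvable_right: "\<lbrakk>a \<in> A; b \<in> A; c \<in> A\<rbrakk> \<Longrightarrow> \<exists>!z. z \<in> A \<and> T a b z = c"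

locale ternary_group = ternary_quasigroup +
  assumes assoc_left: "\<lbrakk>a \<in> A; b \<in> A; c \<in> A; d \<in> A; e \<in> A\<rbrakk>
      \<Longrightarrow> T (T a b c) d e = T a (T b c d) e"
    and assoc_right: "\<lbrakk>a \<in> A; b \<in> A; c \<in> A; d \<in> A; e \<in> A\<rbrakk>
      \<Longrightarrow> T a (T b c d) e = T a b (T c d e)"

text \<open>The definite description below is only meaningful for \<open>a \<in> A\<close> in a ternary quasigroup,
  where the solution exists and is unique by \<open>solvable_middle\<close>.\<close>

definition skew :: "'a set \<Rightarrow> ('a \<Rightarrow> 'a \<Rightarrow> 'a \<Rightarrow> 'a) \<Rightarrow> 'a \<Rightarrow> 'a" where
  "skew A T a = (THE z. z \<in> A \<and> T a z a = a)"

locale knot_theoretic_ternary_group = ternary_group +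
  assumes knot_left: "\<lbrakk>a \<in> A; b \<in> A; c \<in> A; d \<in> A\<rbrakk>
      \<Longrightarrow> T (T a b c) c d = T (T a b (T b c d)) (T b c d) d"
    and knot_right: "\<lbrakk>a \<in> A; b \<in> A; c \<in> A; d \<in> A\<rbrakk>
      \<Longrightarrow> T a b (T b c d) = T a (T a b c) (T (T a b c) c d)"

end

theory Submission
  imports Defs
begin

text \<open>Re-bracketing and cancelling turns the two knot axioms into
  \<open>[ccd] = [uud]\<close> and \<open>[dcc] = [duu]\<close> for all \<open>c, d, u\<close>; the common value is the skew element of \<open>d\<close>.
  So in the covering group all squares of elements of \<open>A\<close> equal one central involution, and
  inverting \<open>[xyz]\<close> there gives \<open>[xyz] = [zyx]\<close>. Fixing \<open>e\<close>, the retract \<open>x + y = [x (skew e) y]\<close> is then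
  an abelian group with \<open>[x (skew y) z] = x - y + z\<close>. Conversely, in \<open>x - y + z + s\<close> repeated adjacent
  arguments cancel.\<close>

context ternary_group
begin

lemma left_cancel: "\<lbrakk>T x a b = T y a b; a \<in> A; b \<in> A; x \<in> A; y \<in> A\<rbrakk> \<Longrightarrow> x = y"
  using solvable_left[of a b "T y a b"] closed by blast

lemma middle_cancel: "\<lbrakk>T a x b = T a y b; a \<in> A; b \<in> A; x \<in> A; y \<in> A\<rbrakk> \<Longrightarrow> x = y"
  using solvable_middle[of a b "T a y b"] closed by blast

lemma right_cancel: "\<lbrakk>T a b x = T a b y; a \<in> A; b \<in> A; x \<in> A; y \<in> A\<rbrakk> \<Longrightarrow> x = y"
  using solvable_right[of a b "T a b y"] closed by blast

lemma assoc_outer: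
  "\<lbrakk>a \<in> A; b \<in> A; c \<in> A; d \<in> A; e \<in> A\<rbrakk> \<Longrightarrow> T (T a b c) d e = T a b (T c d e)"
  by (simp add: assoc_left assoc_right)

lemma
  assumes "a \<in> A"
  shows skew_closed [simp]: "skew A T a \<in> A"
    and skew_self: "T a (skew A T a) a = a"
  using theI'[OF solvable_middle[OF assms assms assms]] unfolding skew_def by auto

lemma skew_unique: "\<lbrakk>T a z a = a; a \<in> A; z \<in> A\<rbrakk> \<Longrightarrow> skew A T a = z"
  using skew_self middle_cancel skew_closed by metis

text \<open>Solvability in the middle writes \<open>b\<close> as \<open>T a z a\<close>;
  re-bracketing then lets the leading \<open>a\<close> absorb its skew element by
  \<open>skew_self\<close>.\<close>

lemma skew_left:
  assumes "a \<in> A" "b \<in> A" shows "T a (skew A T a) b = b"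
proof -
  obtain z where z: "z \<in> A" "T a z a = b"
    using solvable_middle[of a a b] assms by blast
  have "T a (skew A T a) (T a z a) = T a z a"
    using assms z(1) by (simp flip: assoc_outer add: skew_self)
  then show ?thesis unfolding z(2) .
qed

lemma skew_right:
  assumes "a \<in> A" "b \<in> A" shows "T b (skew A T a) a = b"
proof -
  obtain z where z: "z \<in> A" "T a z a = b"
    using solvable_middle[of a a b] assms by blast
  have "T (T a z a) (skew A T a) a = T a z a"
    using assms z(1) by (simp add: assoc_outer skew_self)
  then show ?thesis unfolding z(2) .
qed

lemma skew_skew:
  assumes "a \<in> A" shows "skew A T (skew A T a) = a"
proof (rule skew_unique)
  have "T a (T (skew A T a) a (skew A T a)) a = T a (skew A T a) a"
    using assms by (simp flip: assoc_left add: skew_self)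
  then show "T (skew A T a) a (skew A T a) = skew A T a"
    using assms middle_cancel closed by simp
qed (use assms in auto)

lemma bij_betw_skew: "bij_betw (skew A T) A A"
  by (rule bij_betw_byWitness[where f' = "skew A T"]) (auto simp: skew_skew)

text \<open>Both directions of the theorem pass through this criterion, which trades the knot axioms
  for a condition on squares.\<close>

lemma knot_theoretic_iff:
  "knot_theoretic_ternary_group A T \<longleftrightarrow>
    (\<forall>c\<in>A. \<forall>d\<in>A. T c c d = skew A T d \<and> T d c c = skew A T d)"
proof
  assume "knot_theoretic_ternary_group A T"
  then interpret knot_theoretic_ternary_group A T .
  have square_left: "T c c d = T u u d" if "c \<in> A" "d \<in> A" "u \<in> A" for c d u
  proof -
    \<comment> \<open>Solvability makes \<open>T b c d\<close> an arbitrary prescribed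
      \<open>u\<close>, so that \<open>knot_left\<close> compares the squares of \<open>c\<close>
      and \<open>u\<close> in front of \<open>d\<close>.\<close>
    obtain b where b: "b \<in> A" "T b c d = u"
      using ex1_implies_ex[OF solvable_left[of c d u]] \<open>c \<in> A\<close> \<open>d \<in> A\<close> \<open>u \<in> A\<close> by blast
    have "T b b (T c c d) = T b b (T u u d)"
      using knot_left[of b b c d] that b by (simp add: assoc_outer closed)
    then show ?thesis using right_cancel that b closed by metis
  qed
  have square_right: "T d c c = T d u u" if "c \<in> A" "d \<in> A" "u \<in> A" for c d u
  proof -
    obtain b where b: "b \<in> A" "T d c b = u"
      using ex1_implies_ex[OF solvable_right[of d c u]] \<open>c \<in> A\<close> \<open>d \<in> A\<close> \<open>u \<in> A\<close> by blast
    have "T (T d c c) b b = T (T d u u) b b"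
      using knot_right[of d c b b] that b by (simp flip: assoc_outer add: closed)
    then show ?thesis using left_cancel that b closed by metis
  qed
  show "\<forall>c\<in>A. \<forall>d\<in>A. T c c d = skew A T d \<and> T d c c = skew A T d"
    \<comment> \<open>Take \<open>u\<close> to be the skew element of \<open>d\<close>: next to
      \<open>d\<close>, one of its two copies cancels and the other remains.\<close>
    using square_left square_right skew_left skew_right skew_closed by metis
next
  assume square: "\<forall>c\<in>A. \<forall>d\<in>A. T c c d = skew A T d \<and> T d c c = skew A T d"
  show "knot_theoretic_ternary_group A T"
  proof
    fix a b c d assume [simp]: "a \<in> A" "b \<in> A" "c \<in> A" "d \<in> A"
    \<comment> \<open>Both sides collapse to \<open>T a b (skew A T d)\<close>; in the second axiom
      both collapse to \<open>T (skew A T a) c d\<close>.\<close>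
    show "T (T a b c) c d = T (T a b (T b c d)) (T b c d) d"
      using square by (simp add: assoc_outer[of a b] closed)
    show "T a b (T b c d) = T a (T a b c) (T (T a b c) c d)"
      using square by (simp add: assoc_outer[symmetric, of _ _ _ c d] closed)
  qed
qed

end

context knot_theoretic_ternary_group
begin

lemma square_left: "\<lbrakk>c \<in> A; d \<in> A\<rbrakk> \<Longrightarrow> T c c d = skew A T d"
  and square_right: "\<lbrakk>c \<in> A; d \<in> A\<rbrakk> \<Longrightarrow> T d c c = skew A T d"
  using knot_theoretic_iff knot_theoretic_ternary_group_axioms by blast+

text \<open>Taking the skew element amounts to multiplying by a square on either side, and
  re-bracketing carries that square from the end of the product to its middle entry.\<close>

lemma skew_T_middle:
  assumes "a \<in> A" "b \<in> A" "c \<in> A"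
  shows "skew A T (T a b c) = T a (skew A T b) c"
proof -
  have "T (T a b c) a a = T a b (T c a a)"
    using assms by (simp add: assoc_outer)
  then have right: "skew A T (T a b c) = T a b (skew A T c)"
    using assms by (simp add: square_right closed)
  have "T a (T b a a) c = T a b (T a a c)"
    using assms by (simp add: assoc_right)
  then show "skew A T (T a b c) = T a (skew A T b) c"
    using assms by (simp add: right square_left square_right)
qed

lemma T_commute:
  assumes [simp]: "x \<in> A" "p \<in> A" "y \<in> A"
  shows "T x p y = T y p x"
proof (rule middle_cancel)
  let ?u = "T x p y" and ?v = "T y p x"
  \<comment> \<open>The squares of \<open>y\<close> and \<open>x\<close> each apply
    \<open>skew\<close> to \<open>p\<close>, hence cancel by \<open>skew_skew\<close>.\<close>
  have "T ?u ?v x = T x p (T y y (T p x x))"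
    by (simp add: assoc_outer closed flip: assoc_left)
  also have "\<dots> = T x p p"
    by (simp add: square_left square_right skew_skew)
  also have "\<dots> = T ?u ?u x"
    by (simp add: square_left square_right closed)
  finally show "T ?u ?u x = T ?u ?v x" by simp
qed (simp_all add: closed)

text \<open>The skew element in the middle is what makes \<open>e\<close> neutral, by
  \<open>skew_left\<close> and \<open>skew_right\<close>.\<close>

definition retract :: "'a \<Rightarrow> 'a monoid" where
  "retract e = \<lparr>carrier = A, mult = (\<lambda>x y. T x (skew A T e) y), one = e\<rparr>"

lemma retract_simps [simp]:
  "carrier (retract e) = A" "x \<otimes>\<^bsub>retract e\<^esub> y = T x (skew A T e) y" "\<one>\<^bsub>retract e\<^esub> = e"
  by (simp_all add: retract_def)

lemma retract_left_inverse:
  assumes "e \<in> A" "x \<in> A"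
  shows "T (T e (skew A T x) e) (skew A T e) x = e"
  using assms by (simp add: assoc_outer skew_left skew_right)

lemma comm_group_retract:
  assumes "e \<in> A"
  shows "comm_group (retract e)"
proof (rule comm_groupI)
  fix x assume "x \<in> carrier (retract e)"
  then show "\<exists>y\<in>carrier (retract e). y \<otimes>\<^bsub>retract e\<^esub> x = \<one>\<^bsub>retract e\<^esub>"
    using retract_left_inverse[of e x] assms closed by force
next
  fix x y assume "x \<in> carrier (retract e)" "y \<in> carrier (retract e)"
  then show "x \<otimes>\<^bsub>retract e\<^esub> y = y \<otimes>\<^bsub>retract e\<^esub> x"
    using assms by (simp add: T_commute)
qed (use assms in \<open>simp_all add: closed assoc_outer skew_left\<close>)

lemma inv_retract:
  assumes "e \<in> A" "x \<in> A"
  shows "inv\<^bsub>retract e\<^esub> x = T e (skew A T x) e"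
proof -
  interpret comm_group "retract e" using assms(1) by (rule comm_group_retract)
  show ?thesis
    by (rule inv_equality) (use assms in \<open>simp_all add: retract_left_inverse closed\<close>)
qed

text \<open>In \<open>x - y + z\<close> each skew element of \<open>e\<close> cancels against a
  neighbouring \<open>e\<close> from the inverse, leaving \<open>T x (skew A T y) z\<close>. Adding
  the skew element of \<open>e\<close> applies \<open>skew\<close> to this, which restores
  \<open>y\<close>.\<close>

lemma T_eq_retract:
  assumes [simp]: "e \<in> A" "x \<in> A" "y \<in> A" "z \<in> A"
  shows "T x y z = x \<otimes>\<^bsub>retract e\<^esub> inv\<^bsub>retract e\<^esub> y \<otimes>\<^bsub>retract e\<^esub> z \<otimes>\<^bsub>retract e\<^esub> skew A T e"
proof -
  have "x \<otimes>\<^bsub>retract e\<^esub> inv\<^bsub>retract e\<^esub> y \<otimes>\<^bsub>retract e\<^esub> z = T x (skew A T y) z"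
    by (simp add: inv_retract closed skew_right flip: assoc_outer)
       (simp add: assoc_outer skew_left closed)
  then have "x \<otimes>\<^bsub>retract e\<^esub> inv\<^bsub>retract e\<^esub> y \<otimes>\<^bsub>retract e\<^esub> z \<otimes>\<^bsub>retract e\<^esub> skew A T e
      = skew A T (T x (skew A T y) z)"
    by (simp add: square_right closed)
  then show ?thesis by (simp add: skew_T_middle skew_skew)
qed

end

theorem theorem4p4:
  fixes A :: "'a set" and T :: "'a \<Rightarrow> 'a \<Rightarrow> 'a \<Rightarrow> 'a"
  assumes "ternary_group A T"
  shows "knot_theoretic_ternary_group A T \<longleftrightarrow>
    (\<exists>G :: 'a monoid. comm_group G \<and> carrier G = A \<and>
      (\<forall>x\<in>A. \<forall>y\<in>A. \<forall>z\<in>A.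
        T x y z = x \<otimes>\<^bsub>G\<^esub> inv\<^bsub>G\<^esub> y \<otimes>\<^bsub>G\<^esub> z \<otimes>\<^bsub>G\<^esub> skew A T \<one>\<^bsub>G\<^esub>) \<and>
      bij_betw (skew A T) A A \<and>
      (\<forall>x\<in>A. skew A T (skew A T x) = x) \<and>
      (\<forall>x\<in>A. skew A T x = x \<otimes>\<^bsub>G\<^esub> skew A T \<one>\<^bsub>G\<^esub>))"
    (is "_ \<longleftrightarrow> (\<exists>G. ?P G)")
proof
  assume "knot_theoretic_ternary_group A T"
  then interpret knot_theoretic_ternary_group A T .
  obtain e where e: "e \<in> A" using nonempty by blast
  have "?P (retract e)"
    using e T_eq_retract[OF e]
    \<comment> \<open>The product stays folded to match \<open>T_eq_retract\<close>; unfolding it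
      afterwards makes the last clause an instance of \<open>square_right\<close>.\<close>
    by (simp add: comm_group_retract bij_betw_skew skew_skew square_right del: retract_simps(2))
       (simp add: square_right)
  then show "\<exists>G. ?P G" by (rule exI[of _ "retract e"])
next
  interpret ternary_group A T by fact
  assume "\<exists>G. ?P G"
  then obtain G :: "'a monoid" where "comm_group G" and carrier: "carrier G = A"
    and T: "\<And>x y z. \<lbrakk>x \<in> A; y \<in> A; z \<in> A\<rbrakk> \<Longrightarrow>
      T x y z = x \<otimes>\<^bsub>G\<^esub> inv\<^bsub>G\<^esub> y \<otimes>\<^bsub>G\<^esub> z \<otimes>\<^bsub>G\<^esub> skew A T \<one>\<^bsub>G\<^esub>"
    and skew: "\<And>x. x \<in> A \<Longrightarrow> skew A T x = x \<otimes>\<^bsub>G\<^esub> skew A T \<one>\<^bsub>G\<^esub>"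
    by auto
  interpret comm_group G by fact
  have "T c c d = skew A T d \<and> T d c c = skew A T d" if "c \<in> A" "d \<in> A" for c d
  proof -
    have "skew A T \<one>\<^bsub>G\<^esub> \<in> carrier G"
      using carrier one_closed by simp
    moreover have "c \<in> carrier G" "d \<in> carrier G" using that carrier by simp_all
    \<comment> \<open>Both \<open>c - c + d\<close> and \<open>d - c + c\<close> reduce to
      \<open>d\<close>, and the remaining summand turns \<open>d\<close> into its skew
      element.\<close>
    ultimately show ?thesis
      using that by (simp add: T skew[of d] m_assoc)
  qed
  then show "knot_theoretic_ternary_group A T"
    by (simp add: knot_theoretic_iff)
qed

end
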